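(* Suppose every item of $V$ can be used at most once in the output sequence. Then the function-arriving maximum modular ranking problem (MMR-F) generalizes the online-selection problem, in the following sense: for every $n\ge 1$ and every $\alpha\ge 1$, if there is a (randomized) online algorithm that is an $\alpha$-approximation for MMR-F on all instances with $|V|=n$, then there is a (randomized) online algorithm that is an $\alpha$-approximation for the online-selection problem on all sequences of $n$ numbers. Consequently, no randomized algorithm guarantees an $o(n)$-approximation for MMR-F, where $n=|V|$: there is no function $\alpha:\mathbb{N}\to[1,\infty)$ with $\alpha(n)/n\to 0$ and no randomized online algorithm that, for every $n$, is an $\alpha(n)$-approximation on all MMR-F instances with $|V|=n$.
   Context: A function $f:2^V\to\mathbb{R}_+$ is modular if $f(X)+f(Y)=f(X\cup Y)$ whenever $X\cap Y=\emptyset$. MMR-F (items used at most once): given is a finite set $V$ of $n$ items. At the beginning of each step $t=1,\dots,n$, a finite (possibly empty) collection $\mathcal{F}_t$ of modular functions $f:2^V\to\mathbb{R}_+$ is revealed; each $f\in\mathcal{F}_t$ has arrival time $\tau(f)=t$ and comes with an integer $k(f)$. After seeing $\mathcal{F}_t$, the algorithm irrevocably decides the $t$-th entry $\sigma_t$ of the output sequence $\sigma$: either an item of $V$ not placed at an earlier step, or no item. The decision at step $t$ may depend only on $V$, on $\mathcal{F}_1,\dots,\mathcal{F}_t$ (with their integers $k(f)$), on previous decisions, and on internal randomness. For integers $s,e$, $\sigma[s:e]$ denotes the set of items placed at positions $s,\dots,e$ (empty if $e<s$). The objective value of $\sigma$ is $\sum_t\sum_{f\in\mathcal{F}_t} f(\sigma[t:k(f)])$,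 to be maximized. $\mathrm{OPT}$ is the maximum objective value over all sequences without repeated items, with all functions known in advance. Online-selection problem: nonnegative integers $a_1,\dots,a_n$ are revealed one after another ($n$ is known, the values are chosen adversarially). The algorithm must select exactly one number, immediately after it is revealed and irrevocably (a number passed over cannot be selected later); the value of a solution is the value of the selected number, to be maximized. Here $\mathrm{OPT}=\max_t a_t$. A randomized online algorithm is an $\alpha$-approximation on a class of instances if, for every instance in the class (fixed in advance, independently of the algorithm's randomness), its expected objective value is at least $\mathrm{OPT}/\alpha$. *)

theory Defs
  imports "HOL-Probability.Probability" "HOL-Library.Multiset" "HOL-Library.FuncSet"
begin

section \<open>Randomized online algorithms\<close>

text \<open>
  A policy maps the inputs revealed so far (the current one is last) and the
  previous decisions to the current decision.
\<close>

type_synonym ('i, 'd) policy = "'i list \<Rightarrow> 'd list \<Rightarrow> 'd"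

primrec decisions :: "('i, 'd) policy \<Rightarrow> 'i list \<Rightarrow> nat \<Rightarrow> 'd list" where
  "decisions \<pi> xs 0 = []"
| "decisions \<pi> xs (Suc t) = decisions \<pi> xs t @ [\<pi> (take (Suc t) xs) (decisions \<pi> xs t)]"

definition run :: "('i, 'd) policy \<Rightarrow> 'i list \<Rightarrow> 'd list" where
  "run \<pi> xs = decisions \<pi> xs (length xs)"

text \<open>
  An instance is a pair \<open>(p, xs)\<close> of a part \<open>p\<close> known in advance and the list \<open>xs\<close> of inputs
  revealed step by step.  A randomized online algorithm consists of a probability space \<open>M\<close>
  (the internal randomness) and a policy \<open>A \<omega> p\<close> for each outcome \<open>\<omega>\<close> and each \<open>p\<close>.
  On every instance of the class \<open>I\<close> it has to produce a feasible solution for every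
  outcome; measurability makes the distribution of the output well-defined.
\<close>

definition online_algorithm ::
  "('p \<times> 'i list) set \<Rightarrow> ('p \<Rightarrow> 'd list set) \<Rightarrow>
   'r measure \<Rightarrow> ('r \<Rightarrow> 'p \<Rightarrow> ('i, 'd) policy) \<Rightarrow> bool" where
  "online_algorithm I Sol M A \<longleftrightarrow> prob_space M \<and>
     (\<forall>(p, xs)\<in>I. (\<lambda>\<omega>. run (A \<omega> p) xs) \<in> measurable M (count_space (Sol p)))"

definition online_approximation ::
  "('p \<times> 'i list) set \<Rightarrow> ('p \<Rightarrow> 'd list set) \<Rightarrow> ('i list \<Rightarrow> 'd list \<Rightarrow> real) \<Rightarrow>
   ('p \<Rightarrow> 'i list \<Rightarrow> real) \<Rightarrow> real \<Rightarrow>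
   'r measure \<Rightarrow> ('r \<Rightarrow> 'p \<Rightarrow> ('i, 'd) policy) \<Rightarrow> bool" where
  "online_approximation I Sol val opt \<alpha> M A \<longleftrightarrow> online_algorithm I Sol M A \<and>
     (\<forall>(p, xs)\<in>I. (\<integral>\<omega>. val xs (run (A \<omega> p) xs) \<partial>M) \<ge> opt p xs / \<alpha>)"


section \<open>Function-arriving maximum modular ranking, items used at most once\<close>

definition modular_functions :: "'a set \<Rightarrow> ('a set \<Rightarrow> real) set" where
  "modular_functions V = {f \<in> Pow V \<rightarrow>\<^sub>E {0..}.
     \<forall>X Y. X \<subseteq> V \<longrightarrow> Y \<subseteq> V \<longrightarrow> X \<inter> Y = {} \<longrightarrow> f X + f Y = f (X \<union> Y)}"

text \<open>The collection revealed in one step; each function \<open>f\<close> is paired with \<open>k(f)\<close>.\<close>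

type_synonym 'a collection = "(('a set \<Rightarrow> real) \<times> int) multiset"

text \<open>
  In the list \<open>Fs\<close> the collection of step \<open>t \<in> {1..n}\<close> is \<open>Fs ! (t - 1)\<close>; likewise, position \<open>t\<close>
  of an output sequence \<open>\<sigma>\<close> is \<open>\<sigma> ! (t - 1)\<close>, where \<open>None\<close> stands for no item.
\<close>

definition mmrf_instances :: "nat \<Rightarrow> ('a set \<times> 'a collection list) set" where
  "mmrf_instances n = {(V, Fs). finite V \<and> card V = n \<and> length Fs = n \<and>
     (\<forall>F\<in>set Fs. \<forall>(f, k)\<in>#F. f \<in> modular_functions V)}"

definition mmrf_sequences :: "'a set \<Rightarrow> 'a option list set" where
  "mmrf_sequences V = {\<sigma>. length \<sigma> = card V \<and> set \<sigma> \<subseteq> insert None (Some ` V) \<and>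
     (\<forall>i<length \<sigma>. \<forall>j<length \<sigma>. i \<noteq> j \<longrightarrow> \<sigma> ! i \<noteq> None \<longrightarrow> \<sigma> ! i \<noteq> \<sigma> ! j)}"

text \<open>The set \<open>\<sigma>[s:e]\<close>.\<close>

definition placed :: "'a option list \<Rightarrow> int \<Rightarrow> int \<Rightarrow> 'a set" where
  "placed \<sigma> s e = {v. \<exists>t\<in>{1..length \<sigma>}. s \<le> int t \<and> int t \<le> e \<and> \<sigma> ! (t - 1) = Some v}"

definition mmrf_value :: "'a collection list \<Rightarrow> 'a option list \<Rightarrow> real" where
  "mmrf_value Fs \<sigma> =
     (\<Sum>t=1..length Fs. \<Sum>(f, k)\<in>#Fs ! (t - 1). f (placed \<sigma> (int t) k))"

definition mmrf_opt :: "'a set \<Rightarrow> 'a collection list \<Rightarrow> real" where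
  "mmrf_opt V Fs = Max (mmrf_value Fs ` mmrf_sequences V)"

definition mmrf_approximation ::
  "nat \<Rightarrow> real \<Rightarrow> 'r measure \<Rightarrow> ('r \<Rightarrow> 'a set \<Rightarrow> ('a collection, 'a option) policy) \<Rightarrow> bool" where
  "mmrf_approximation n =
     online_approximation (mmrf_instances n) mmrf_sequences mmrf_value mmrf_opt"


section \<open>Online selection\<close>

text \<open>Known in advance is the length \<open>n\<close>; the decision of a step says whether the number
  just revealed is selected.\<close>

definition selection_instances :: "nat \<Rightarrow> (nat \<times> nat list) set" where
  "selection_instances n = {(m, as). m = n \<and> length as = n}"

definition selections :: "nat \<Rightarrow> bool list set" where
  "selections n = {bs. length bs = n \<and> (\<exists>!t. t < n \<and> bs ! t)}"

definition selection_value :: "nat list \<Rightarrow> bool list \<Rightarrow> real" where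
  "selection_value as bs = real (as ! (THE t. t < length bs \<and> bs ! t))"

definition selection_opt :: "nat \<Rightarrow> nat list \<Rightarrow> real" where
  "selection_opt n as = real (Max (set as))"

definition selection_approximation ::
  "nat \<Rightarrow> real \<Rightarrow> 'r measure \<Rightarrow> ('r \<Rightarrow> nat \<Rightarrow> (nat, bool) policy) \<Rightarrow> bool" where
  "selection_approximation n =
     online_approximation (selection_instances n) selections selection_value selection_opt"

end

theory Submission
  imports Defs
begin

text \<open>
  To select a number online, fix one item \<open>v \<in> V\<close> and let step \<open>t\<close> reveal the single function
  \<open>f\<^sub>t(X) = a\<^sub>t [v \<in> X]\<close> with \<open>k(f\<^sub>t) = t\<close>.  The ranking then earns exactly the number revealed
  when \<open>v\<close> is placed, so placing \<open>v\<close> amounts to selecting a number (the last one, if \<open>v\<close> is never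
  placed).  The reduction keeps the probability space.

  For the lower bound consider the sequences \<open>1, H, \<dots>, H\<^sup>k, 0, \<dots>, 0\<close> for \<open>k < n\<close>.  An algorithm
  cannot tell them apart before they drop to \<open>0\<close>, so if \<open>p\<^sub>k\<close> is the probability that it selects
  position \<open>k\<close> of \<open>1, H, \<dots>, H\<^sup>n\<^sup>-\<^sup>1\<close>, then \<open>1/\<alpha> \<le> p\<^sub>k + 1/H\<close>.  Summing over \<open>k\<close> gives
  \<open>n/\<alpha> \<le> 1 + n/H\<close>, and \<open>H \<rightarrow> \<infinity>\<close> yields \<open>n \<le> \<alpha>\<close>.
\<close>

section \<open>Runs of a policy and their prefixes\<close>

lemma length_decisions [simp]: "length (decisions \<pi> xs t) = t"
  by (induction t) auto

lemma length_run [simp]: "length (run \<pi> xs) = length xs"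
  by (simp add: run_def)

lemma decisions_take: "t \<le> s \<Longrightarrow> decisions \<pi> (take s xs) t = decisions \<pi> xs t"
  by (induction t) (auto simp: min_def)

lemma take_decisions: "s \<le> t \<Longrightarrow> take s (decisions \<pi> xs t) = decisions \<pi> xs s"
proof (induction t)
  case (Suc t)
  then show ?case by (cases "s = Suc t") auto
qed simp

lemma take_run: "t \<le> length xs \<Longrightarrow> take t (run \<pi> xs) = run \<pi> (take t xs)"
  by (simp add: run_def take_decisions decisions_take min_def)

text \<open>A policy sees only the first \<open>Suc i\<close> inputs when it takes decision
  \<open>i\<close>, so inputs that agree that far cannot be told apart. The lower bound compares its
  hard sequences in this way.\<close>

lemma run_nth_cong:
  assumes "take (Suc i) xs = take (Suc i) ys" "i < length xs" "i < length ys"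
  shows "run \<pi> xs ! i = run \<pi> ys ! i"
proof -
  have "run \<pi> xs ! i = take (Suc i) (run \<pi> xs) ! i" by simp
  also have "\<dots> = take (Suc i) (run \<pi> ys) ! i" using assms by (simp add: take_run)
  finally show ?thesis by simp
qed

text \<open>Serves \<open>selection_by_ranking\<close>, which recomputes everything from the inputs
  and ignores earlier decisions, so that its run can be read off entry by entry.\<close>

lemma run_memoryless:
  "run (\<lambda>ys ds. g ys) xs = map (\<lambda>i. g (take (Suc i) xs)) [0..<length xs]"
proof -
  have "decisions (\<lambda>ys ds. g ys) xs t = map (\<lambda>i. g (take (Suc i) xs)) [0..<t]" for t
    by (induction t) auto
  then show ?thesis by (simp add: run_def)
qed

section \<open>Integrability over finite solution sets\<close>

text \<open>The sum of the norms of \<open>g\<close> over the finite set \<open>S\<close> is a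
  constant bound. This supplies the integrability that \<open>integral_mono\<close> requires when
  expectations are compared.\<close>

lemma (in prob_space) integrable_of_finite_range:
  fixes g :: "'b \<Rightarrow> real"
  assumes "X \<in> measurable M (count_space S)" "finite S"
  shows "integrable M (\<lambda>\<omega>. g (X \<omega>))"
proof (rule integrable_const_bound)
  have "X \<omega> \<in> S" if "\<omega> \<in> space M" for \<omega>
    using measurable_space[OF assms(1) that] by simp
  then show "AE \<omega> in M. norm (g (X \<omega>)) \<le> (\<Sum>s\<in>S. norm (g s))"
    using assms(2) by (intro AE_I2 member_le_sum) auto
  have "g \<in> borel_measurable (count_space S)" by simp
  from measurable_compose[OF assms(1) this] show "(\<lambda>\<omega>. g (X \<omega>)) \<in> borel_measurable M" .
qed

lemma finite_mmrf_sequences: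
  assumes "finite V"
  shows "finite (mmrf_sequences V)"
proof (rule finite_subset)
  show "mmrf_sequences V \<subseteq> {\<sigma>. set \<sigma> \<subseteq> insert None (Some ` V) \<and> length \<sigma> = card V}"
    by (auto simp: mmrf_sequences_def)
  show "finite {\<sigma>. set \<sigma> \<subseteq> insert None (Some ` V) \<and> length \<sigma> = card V}"
    using assms by (intro finite_lists_length_eq) auto
qed

lemma finite_selections: "finite (selections n)"
proof (rule finite_subset)
  show "selections n \<subseteq> {bs. set bs \<subseteq> UNIV \<and> length bs = n}"
    by (auto simp: selections_def)
qed (rule finite_lists_length_eq, simp)

lemma selection_value_eq:
  assumes "bs \<in> selections n" "i < n" "bs ! i"
  shows "selection_value as bs = real (as ! i)"
proof -
  have "(THE t. t < length bs \<and> bs ! t) = i"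
    using assms by (intro the_equality) (auto simp: selections_def)
  then show ?thesis by (simp add: selection_value_def)
qed

subsection \<open>Selection by ranking\<close>

text \<open>The restriction to \<open>Pow V\<close> makes the function extensional, as
  \<open>modular_functions\<close> demands.\<close>

definition item_reward :: "'a set \<Rightarrow> 'a \<Rightarrow> nat \<Rightarrow> 'a set \<Rightarrow> real" where
  "item_reward V v a = (\<lambda>X\<in>Pow V. if v \<in> X then real a else 0)"

text \<open>List index \<open>i\<close> is step \<open>Suc i\<close>; taking this step as the
  integer \<open>k(f)\<close> shrinks the rewarded window to the single position filled on
  arrival.\<close>

definition ranking_inputs :: "'a set \<Rightarrow> 'a \<Rightarrow> nat list \<Rightarrow> 'a collection list" where
  "ranking_inputs V v as = map (\<lambda>i. {#(item_reward V v (as ! i), int (Suc i))#}) [0..<length as]"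

text \<open>A selection must pick one number, while a ranking may leave \<open>v\<close> out; the
  second disjunct then picks the last position. This can be decided online because \<sigma> is
  complete at the last step.\<close>

definition placement :: "'a \<Rightarrow> nat \<Rightarrow> 'a option list \<Rightarrow> bool list" where
  "placement v n \<sigma> =
     map (\<lambda>i. \<sigma> ! i = Some v \<or> Suc i = n \<and> Some v \<notin> set \<sigma>) [0..<length \<sigma>]"

lemma length_ranking_inputs [simp]: "length (ranking_inputs V v as) = length as"
  by (simp add: ranking_inputs_def)

text \<open>Each collection depends only on the number of its own step, so the translation can be
  carried out online.\<close>

lemma take_ranking_inputs:
  "take t (ranking_inputs V v as) = ranking_inputs V v (take t as)"
  by (rule nth_equalityI) (auto simp: ranking_inputs_def)

lemma item_reward_modular: "item_reward V v a \<in> modular_functions V"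
proof -
  have "item_reward V v a \<in> Pow V \<rightarrow>\<^sub>E {0..}"
    unfolding item_reward_def by (rule restrict_PiE_iff[THEN iffD2]) simp
  moreover have "item_reward V v a X + item_reward V v a Y = item_reward V v a (X \<union> Y)"
    if "X \<subseteq> V" "Y \<subseteq> V" "X \<inter> Y = {}" for X Y
  proof -
    \<comment> \<open>Disjointness lets at most one of \<open>X\<close> and \<open>Y\<close> earn
      the reward.\<close>
    have "\<not> (v \<in> X \<and> v \<in> Y)" using that(3) by blast
    then show ?thesis using that(1,2) by (simp add: item_reward_def)
  qed
  ultimately show ?thesis by (simp add: modular_functions_def)
qed

lemma ranking_inputs_instance:
  assumes "finite V" "length as = card V"
  shows "(V, ranking_inputs V v as) \<in> mmrf_instances (card V)"
  using assms by (auto simp: mmrf_instances_def ranking_inputs_def item_reward_modular)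

lemma placed_single:
  assumes "i < length \<sigma>"
  shows "placed \<sigma> (int (Suc i)) (int (Suc i)) = {v. \<sigma> ! i = Some v}"
proof -
  have "v \<in> placed \<sigma> (int (Suc i)) (int (Suc i)) \<longleftrightarrow>
      (\<exists>t\<in>{1..length \<sigma>}. t = Suc i \<and> \<sigma> ! (t - 1) = Some v)" for v
    unfolding placed_def mem_Collect_eq by (intro bex_cong) auto
  then show ?thesis using assms by auto
qed

lemma mmrf_value_ranking_inputs:
  assumes "\<sigma> \<in> mmrf_sequences V" "length as = card V"
  shows "mmrf_value (ranking_inputs V v as) \<sigma> =
    (\<Sum>i<card V. if \<sigma> ! i = Some v then real (as ! i) else 0)"
proof -
  have len: "length \<sigma> = card V" and sub: "set \<sigma> \<subseteq> insert None (Some ` V)"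
    using assms by (auto simp: mmrf_sequences_def)
  have "mmrf_value (ranking_inputs V v as) \<sigma> =
    (\<Sum>i<card V. \<Sum>(f, k)\<in>#ranking_inputs V v as ! i. f (placed \<sigma> (int (Suc i)) k))"
    unfolding mmrf_value_def using assms(2)
    by (simp add: sum.atLeast1_atMost_eq)
  also have "\<dots> = (\<Sum>i<card V. if \<sigma> ! i = Some v then real (as ! i) else 0)"
  proof (rule sum.cong)
    fix i assume "i \<in> {..<card V}"
    then have i: "i < card V" by simp
    then have "\<sigma> ! i \<in> set \<sigma>" using len by simp
    \<comment> \<open>Membership in \<open>Pow V\<close> is needed to evaluate the restricted
      function.\<close>
    then have "{w. \<sigma> ! i = Some w} \<subseteq> V" using sub by auto
    then show "(\<Sum>(f, k)\<in>#ranking_inputs V v as ! i. f (placed \<sigma> (int (Suc i)) k)) =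
      (if \<sigma> ! i = Some v then real (as ! i) else 0)"
      using i assms(2) placed_single[of i \<sigma>] len
      by (simp add: ranking_inputs_def item_reward_def del: of_nat_Suc)
  qed simp
  finally show ?thesis .
qed

text \<open>Placing \<open>v\<close> at the step of a maximal number, and nothing elsewhere, earns
  that number.\<close>

lemma mmrf_opt_ranking_inputs_ge:
  assumes "finite V" "v \<in> V" "length as = card V"
  shows "selection_opt (card V) as \<le> mmrf_opt V (ranking_inputs V v as)"
proof -
  have "as \<noteq> []" using assms by auto
  then have "Max (set as) \<in> set as" by (intro Max_in) auto
  then obtain j where j: "j < card V" "as ! j = Max (set as)"
    using assms by (auto simp: in_set_conv_nth)
  define \<sigma> where "\<sigma> = map (\<lambda>i. if i = j then Some v else None) [0..<card V]"
  have \<sigma>: "\<sigma> \<in> mmrf_sequences V"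
    using assms by (auto simp: mmrf_sequences_def \<sigma>_def)
  have "mmrf_value (ranking_inputs V v as) \<sigma> =
      (\<Sum>i<card V. if i = j then real (as ! i) else 0)"
    unfolding mmrf_value_ranking_inputs[OF \<sigma> assms(3)]
    by (rule sum.cong) (auto simp: \<sigma>_def)
  then have "mmrf_value (ranking_inputs V v as) \<sigma> = selection_opt (card V) as"
    using j by (simp add: selection_opt_def)
  moreover have "mmrf_value (ranking_inputs V v as) \<sigma> \<le> mmrf_opt V (ranking_inputs V v as)"
    unfolding mmrf_opt_def using \<sigma> finite_mmrf_sequences[OF assms(1)] by (intro Max_ge) auto
  ultimately show ?thesis by simp
qed

section \<open>From rankings back to selections\<close>

lemma placement_cases:
  assumes "\<sigma> \<in> mmrf_sequences V" "0 < card V"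
  obtains i where "i < card V" "\<sigma> ! i = Some v" "\<forall>j<card V. \<sigma> ! j = Some v \<longrightarrow> j = i"
      "\<forall>j<card V. placement v (card V) \<sigma> ! j \<longleftrightarrow> j = i"
    | "\<forall>j<card V. \<sigma> ! j \<noteq> Some v"
      "\<forall>j<card V. placement v (card V) \<sigma> ! j \<longleftrightarrow> j = card V - 1"
proof (cases "Some v \<in> set \<sigma>")
  case True
  have len: "length \<sigma> = card V" using assms by (simp add: mmrf_sequences_def)
  from True obtain i where i: "i < card V" "\<sigma> ! i = Some v"
    using len by (auto simp: in_set_conv_nth)
  have uniq: "\<forall>j<card V. \<sigma> ! j = Some v \<longrightarrow> j = i"
  proof (intro allI impI)
    fix j assume "j < card V" "\<sigma> ! j = Some v"
    moreover have "i < length \<sigma> \<longrightarrow> j < length \<sigma> \<longrightarrow> i \<noteq> j \<longrightarrow> \<sigma> ! i \<noteq> None \<longrightarrow> \<sigma> ! i \<noteq> \<sigma> ! j"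
      using assms(1) unfolding mmrf_sequences_def by blast
    ultimately show "j = i" using i len by auto
  qed
  have "placement v (card V) \<sigma> ! j \<longleftrightarrow> \<sigma> ! j = Some v" if "j < card V" for j
    using that True len by (simp add: placement_def)
  then have "\<forall>j<card V. placement v (card V) \<sigma> ! j \<longleftrightarrow> j = i"
    using uniq i by blast
  with i uniq show thesis by (rule that(1))
next
  case False
  have len: "length \<sigma> = card V" using assms by (simp add: mmrf_sequences_def)
  have "\<sigma> ! j \<noteq> Some v" if "j < card V" for j
    using False that len by (metis nth_mem)
  moreover from this have "placement v (card V) \<sigma> ! j \<longleftrightarrow> j = card V - 1" if "j < card V" for j
    using False that len assms(2) by (auto simp: placement_def)
  ultimately show thesis by (intro that(2)) blast+
qed

lemma placement_selections:
  assumes "\<sigma> \<in> mmrf_sequences V" "0 < card V"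
  shows "placement v (card V) \<sigma> \<in> selections (card V)"
proof -
  have "length (placement v (card V) \<sigma>) = card V"
    using assms by (simp add: placement_def mmrf_sequences_def)
  moreover have "\<exists>!t. t < card V \<and> placement v (card V) \<sigma> ! t"
  proof (rule placement_cases[OF assms, of v])
    fix i
    assume "i < card V" "\<forall>j<card V. placement v (card V) \<sigma> ! j \<longleftrightarrow> j = i"
    then show ?thesis by (intro ex1I[of _ i]) auto
  next
    assume "\<forall>j<card V. placement v (card V) \<sigma> ! j \<longleftrightarrow> j = card V - 1"
    then show ?thesis using assms by (intro ex1I[of _ "card V - 1"]) auto
  qed
  ultimately show ?thesis by (simp add: selections_def)
qed

text \<open>Equality holds if \<open>v\<close> is placed. Otherwise the ranking earns 0, and the
  number selected by default is nonnegative.\<close>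

lemma mmrf_value_le_selection_value:
  assumes "\<sigma> \<in> mmrf_sequences V" "0 < card V" "length as = card V"
  shows "mmrf_value (ranking_inputs V v as) \<sigma> \<le> selection_value as (placement v (card V) \<sigma>)"
proof (rule placement_cases[OF assms(1,2), of v])
  fix i
  assume i: "i < card V" "\<sigma> ! i = Some v" "\<forall>j<card V. \<sigma> ! j = Some v \<longrightarrow> j = i"
    "\<forall>j<card V. placement v (card V) \<sigma> ! j \<longleftrightarrow> j = i"
  have "\<sigma> ! j = Some v \<longleftrightarrow> j = i" if "j < card V" for j
    using i(2,3) that by blast
  then have "mmrf_value (ranking_inputs V v as) \<sigma> = (\<Sum>j<card V. if j = i then real (as ! j) else 0)"
    unfolding mmrf_value_ranking_inputs[OF assms(1,3)] by (intro sum.cong) simp_all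
  also have "\<dots> = real (as ! i)" using i(1) by simp
  also have "\<dots> = selection_value as (placement v (card V) \<sigma>)"
  proof (rule selection_value_eq[OF placement_selections[OF assms(1,2)], symmetric])
    show "placement v (card V) \<sigma> ! i" using i(1,4) by blast
  qed (rule i(1))
  finally show ?thesis by simp
next
  assume "\<forall>j<card V. \<sigma> ! j \<noteq> Some v"
  then show ?thesis
    by (simp add: mmrf_value_ranking_inputs[OF assms(1,3)] selection_value_def)
qed

section \<open>The online reduction\<close>

text \<open>Each step reruns the ranking policy on the translated prefix with the same \<omega>;
  \<open>last \<sigma>\<close> is its current decision, and \<open>length as = n\<close> recognizes
  the final step.\<close>

definition selection_by_ranking ::
  "'a set \<Rightarrow> 'a \<Rightarrow> ('r \<Rightarrow> 'a set \<Rightarrow> ('a collection, 'a option) policy) \<Rightarrow>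
   'r \<Rightarrow> nat \<Rightarrow> (nat, bool) policy" where
  "selection_by_ranking V v A \<omega> n = (\<lambda>as ds.
     let \<sigma> = run (A \<omega> V) (ranking_inputs V v as)
     in last \<sigma> = Some v \<or> length as = n \<and> Some v \<notin> set \<sigma>)"

text \<open>The rerun on a prefix yields the prefix of the full ranking, so the repeated simulations
  are consistent. At the final step the prefix is the whole ranking, which makes the default agree
  with \<open>placement\<close>.\<close>

lemma run_selection_by_ranking:
  "run (selection_by_ranking V v A \<omega> (length as)) as =
     placement v (length as) (run (A \<omega> V) (ranking_inputs V v as))"
proof -
  define \<sigma> where "\<sigma> = run (A \<omega> V) (ranking_inputs V v as)"
  have pref: "run (A \<omega> V) (ranking_inputs V v (take (Suc i) as)) = take (Suc i) \<sigma>"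
    if "i < length as" for i
    using that by (simp add: \<sigma>_def take_run take_ranking_inputs)
  have "last (take (Suc i) \<sigma>) = \<sigma> ! i" if "i < length as" for i
    using that by (simp add: take_Suc_conv_app_nth \<sigma>_def)
  then show ?thesis
    unfolding selection_by_ranking_def run_memoryless placement_def \<sigma>_def[symmetric] Let_def
    using pref by (auto simp: \<sigma>_def)
qed

text \<open>The selection optimum is at most the ranking optimum, and each outcome of the ranking
  earns at most what the derived selection earns; the guarantee for ranking links the two.\<close>

lemma selection_approximation_of_mmrf_approximation:
  fixes A :: "'r \<Rightarrow> 'a set \<Rightarrow> ('a collection, 'a option) policy"
  assumes "mmrf_approximation n \<alpha> M A" "finite V" "card V = n" "v \<in> V" "0 \<le> \<alpha>"
  shows "selection_approximation n \<alpha> M (selection_by_ranking V v A)"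
proof -
  have "0 < card V" using assms by (auto simp: card_gt_0_iff)
  interpret prob_space M
    using assms by (simp add: mmrf_approximation_def online_approximation_def online_algorithm_def)
  have meas: "(\<lambda>\<omega>. run (selection_by_ranking V v A \<omega> n) as)
        \<in> measurable M (count_space (selections n))" (is ?meas)
    and val: "selection_opt n as / \<alpha> \<le>
        (\<integral>\<omega>. selection_value as (run (selection_by_ranking V v A \<omega> n) as) \<partial>M)" (is ?val)
    if len: "length as = n" for as
  proof -
    define X where "X \<omega> = run (A \<omega> V) (ranking_inputs V v as)" for \<omega>
    have inst: "(V, ranking_inputs V v as) \<in> mmrf_instances n"
      using ranking_inputs_instance[of V as v] assms len by simp
    then have X: "X \<in> measurable M (count_space (mmrf_sequences V))"
      and Xval: "mmrf_opt V (ranking_inputs V v as) / \<alpha> \<le>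
        (\<integral>\<omega>. mmrf_value (ranking_inputs V v as) (X \<omega>) \<partial>M)"
      using assms(1)
      unfolding mmrf_approximation_def online_approximation_def online_algorithm_def X_def[abs_def]
      by blast+
    have B: "run (selection_by_ranking V v A \<omega> n) as = placement v n (X \<omega>)" for \<omega>
      using run_selection_by_ranking[of V v A \<omega> as] len by (simp add: X_def)
    \<comment> \<open>Between count spaces it suffices that feasible rankings map to feasible
      selections.\<close>
    have "placement v n \<in> measurable (count_space (mmrf_sequences V)) (count_space (selections n))"
      using placement_selections[OF _ \<open>0 < card V\<close>] assms(3) by auto
    from measurable_compose[OF X this] show ?meas by (simp add: B)
    have "selection_opt n as / \<alpha> \<le> mmrf_opt V (ranking_inputs V v as) / \<alpha>"
      using mmrf_opt_ranking_inputs_ge[of V v as] assms len by (intro divide_right_mono) auto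
    also note Xval
    also have "(\<integral>\<omega>. mmrf_value (ranking_inputs V v as) (X \<omega>) \<partial>M) \<le>
      (\<integral>\<omega>. selection_value as (placement v n (X \<omega>)) \<partial>M)"
    proof (rule integral_mono)
      fix \<omega> assume "\<omega> \<in> space M"
      then have "X \<omega> \<in> mmrf_sequences V" using measurable_space[OF X] by simp
      from mmrf_value_le_selection_value[OF this \<open>0 < card V\<close>, of as v]
      show "mmrf_value (ranking_inputs V v as) (X \<omega>) \<le> selection_value as (placement v n (X \<omega>))"
        using assms(3) len by simp
    qed (rule integrable_of_finite_range[OF X finite_mmrf_sequences[OF assms(2)]])+
    finally show ?val by (simp add: B)
  qed
  show ?thesis
    unfolding selection_approximation_def online_approximation_def online_algorithm_def
    using prob_space_axioms by (auto simp: selection_instances_def meas val)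
qed

subsection \<open>The lower bound for online selection\<close>

lemma selection_approximation_ge:
  assumes "selection_approximation n \<alpha> M B" "0 < \<alpha>"
  shows "real n \<le> \<alpha>"
proof -
  interpret prob_space M
    using assms(1)
    by (simp add: selection_approximation_def online_approximation_def online_algorithm_def)
  have meas: "(\<lambda>\<omega>. run (B \<omega> n) as) \<in> measurable M (count_space (selections n))"
    and val: "selection_opt n as / \<alpha> \<le> (\<integral>\<omega>. selection_value as (run (B \<omega> n) as) \<partial>M)"
    if "length as = n" for as
    using assms(1) that
    by (auto simp: selection_approximation_def online_approximation_def online_algorithm_def
        selection_instances_def)
  have bound: "real n / \<alpha> \<le> 1 + real n / real H" if H: "1 \<le> H" for H
  proof -
    \<comment> \<open>The sequence \<open>as n\<close> never drops to 0; for \<open>k < n\<close>,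
      \<open>as k\<close> agrees with it up to and including position \<open>k\<close>.\<close>
    define as where "as k = map (\<lambda>t. if t \<le> k then H ^ t else 0) [0..<n]" for k
    define Y where "Y \<omega> = run (B \<omega> n) (as n)" for \<omega>
    have len [simp]: "length (as k) = n" for k by (simp add: as_def)
    have Y: "Y \<in> measurable M (count_space (selections n))"
      using meas[of "as n"] by (simp add: Y_def[abs_def])
    have int: "integrable M (\<lambda>\<omega>. of_bool (Y \<omega> ! k) :: real)" for k
      using integrable_of_finite_range[OF Y finite_selections, of "\<lambda>bs. of_bool (bs ! k)"] .
    have step: "1 / \<alpha> \<le> (\<integral>\<omega>. of_bool (Y \<omega> ! k) \<partial>M) + 1 / H" if k: "k < n" for k
    proof -
      have "Max (set (as k)) \<ge> as k ! k" using k by (intro Max_ge) auto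
      then have "real H ^ k / \<alpha> \<le> selection_opt n (as k) / \<alpha>"
        using k assms(2) by (intro divide_right_mono)
          (auto simp: selection_opt_def as_def simp flip: of_nat_power)
      also note val[OF len]
      \<comment> \<open>Selecting position \<open>k\<close> earns \<open>real H ^ k\<close>, an
        earlier position at most \<open>real H ^ k / H\<close>, and a later one 0.\<close>
      also have "(\<integral>\<omega>. selection_value (as k) (run (B \<omega> n) (as k)) \<partial>M) \<le>
        (\<integral>\<omega>. real H ^ k * of_bool (Y \<omega> ! k) + real H ^ k / H \<partial>M)"
      proof (rule integral_mono)
        show "integrable M (\<lambda>\<omega>. selection_value (as k) (run (B \<omega> n) (as k)))"
          by (rule integrable_of_finite_range[OF meas[OF len] finite_selections])
        show "integrable M (\<lambda>\<omega>. real H ^ k * of_bool (Y \<omega> ! k) + real H ^ k / H)"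
          using int by simp
        fix \<omega> assume "\<omega> \<in> space M"
        then have sel: "run (B \<omega> n) (as k) \<in> selections n"
          using measurable_space[OF meas[OF len[of k]]] by simp
        then obtain i where i: "i < n" "run (B \<omega> n) (as k) ! i"
          by (auto simp: selections_def)
        have eq: "selection_value (as k) (run (B \<omega> n) (as k)) = (if i \<le> k then real H ^ i else 0)"
          using selection_value_eq[OF sel i] i(1) by (simp add: as_def)
        consider "i < k" | "i = k" | "k < i" by linarith
        then show "selection_value (as k) (run (B \<omega> n) (as k)) \<le>
          real H ^ k * of_bool (Y \<omega> ! k) + real H ^ k / H"
        proof cases
          case 1
          then have "real H ^ Suc i \<le> real H ^ k" using H by (intro power_increasing) auto
          then have "real H ^ i \<le> real H ^ k / H" using H by (simp add: field_simps)
          also have "\<dots> \<le> real H ^ k * of_bool (Y \<omega> ! k) + real H ^ k / H" by simp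
          finally show ?thesis using 1 eq by simp
        next
          case 2
          \<comment> \<open>The run on \<open>as n\<close> makes the same decision at position
            \<open>k\<close>, which ties every \<open>k\<close> to the single random selection
            \<open>Y\<close>.\<close>
          have "take (Suc k) (as k) = take (Suc k) (as n)"
            using k by (intro nth_equalityI) (auto simp: as_def)
          then have "Y \<omega> ! k" using run_nth_cong[of k "as k" "as n" "B \<omega> n"] i(2) 2 k len
            unfolding Y_def by metis
          then show ?thesis using 2 eq by simp
        next
          case 3
          then show ?thesis using eq by simp
        qed
      qed
      also have "\<dots> = real H ^ k * ((\<integral>\<omega>. of_bool (Y \<omega> ! k) \<partial>M) + 1 / H)"
        using int by (simp add: prob_space field_simps)
      finally have "real H ^ k * (1 / \<alpha>) \<le> real H ^ k * ((\<integral>\<omega>. of_bool (Y \<omega> ! k) \<partial>M) + 1 / H)"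
        by simp
      then show ?thesis by (rule mult_left_le_imp_le) (use H in simp)
    qed
    \<comment> \<open>Exactly one position is selected in each outcome, so the selection
      probabilities add up to 1.\<close>
    have "(\<Sum>k<n. \<integral>\<omega>. of_bool (Y \<omega> ! k) \<partial>M) = (\<integral>\<omega>. (\<Sum>k<n. of_bool (Y \<omega> ! k) :: real) \<partial>M)"
      using int by (subst Bochner_Integration.integral_sum) auto
    also have "\<dots> = (\<integral>\<omega>. (1::real) \<partial>M)"
    proof (rule Bochner_Integration.integral_cong)
      fix \<omega> assume "\<omega> \<in> space M"
      then have "Y \<omega> \<in> selections n" using measurable_space[OF Y] by simp
      then have "\<exists>!i. i < n \<and> Y \<omega> ! i" by (simp add: selections_def)
      then obtain i where i: "i < n" "Y \<omega> ! i" and "\<And>j. j < n \<Longrightarrow> Y \<omega> ! j \<Longrightarrow> j = i"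
        by blast
      then have "Y \<omega> ! j \<longleftrightarrow> j = i" if "j < n" for j using that by blast
      then have "(\<Sum>k<n. of_bool (Y \<omega> ! k)) = (\<Sum>k<n. if k = i then 1 else (0::real))"
        by (intro sum.cong) simp_all
      then show "(\<Sum>k<n. of_bool (Y \<omega> ! k)) = (1::real)" using i by simp
    qed simp
    finally have one: "(\<Sum>k<n. \<integral>\<omega>. of_bool (Y \<omega> ! k) \<partial>M) = (1::real)"
      by (simp add: prob_space)
    have "(\<Sum>k<n. 1 / \<alpha>) \<le> (\<Sum>k<n. (\<integral>\<omega>. of_bool (Y \<omega> ! k) \<partial>M) + 1 / H)"
      by (intro sum_mono step) simp
    then show ?thesis by (simp add: sum.distrib one)
  qed
  \<comment> \<open>The bound holds from \<open>H = 1\<close> on and therefore passes to the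
    limit.\<close>
  have "(\<lambda>H. 1 + real n / real H) \<longlonglongrightarrow> 1 + 0"
    by (intro tendsto_intros lim_const_over_n)
  then have "real n / \<alpha> \<le> 1 + 0"
    by (rule LIMSEQ_le_const) (use bound in blast)
  then show ?thesis using assms(2) by (simp add: field_simps)
qed

section \<open>Reduction and linear lower bound for ranking\<close>

theorem theorem4p1:
  assumes "infinite (UNIV :: 'a set)"
  shows "(\<forall>n\<ge>1. \<forall>\<alpha>\<ge>1.
            (\<exists>(M :: 'r measure) (A :: 'r \<Rightarrow> 'a set \<Rightarrow> ('a collection, 'a option) policy).
               mmrf_approximation n \<alpha> M A) \<longrightarrow>
            (\<exists>(M :: 'r measure) B. selection_approximation n \<alpha> M B)) \<and>
         \<not> (\<exists>(\<alpha> :: nat \<Rightarrow> real) (M :: 'r measure)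
               (A :: 'r \<Rightarrow> 'a set \<Rightarrow> ('a collection, 'a option) policy).
               (\<forall>n. 1 \<le> \<alpha> n) \<and> (\<lambda>n. \<alpha> n / real n) \<longlonglongrightarrow> 0 \<and>
               (\<forall>n. mmrf_approximation n (\<alpha> n) M A))"
proof -
  have reduction: "\<exists>B. selection_approximation n \<alpha> M B"
    if n: "1 \<le> n" and \<alpha>: "1 \<le> \<alpha>" and approx: "mmrf_approximation n \<alpha> M A"
    for n \<alpha> and M :: "'r measure" and A :: "'r \<Rightarrow> 'a set \<Rightarrow> ('a collection, 'a option) policy"
  proof -
    \<comment> \<open>An infinite item type provides item sets of every finite size.\<close>
    obtain V :: "'a set" where V: "finite V" "card V = n"
      using infinite_arbitrarily_large[OF assms] by blast
    then obtain v where "v \<in> V" using n by fastforce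
    then show ?thesis
      using selection_approximation_of_mmrf_approximation[OF approx V] \<alpha> by auto
  qed
  have "\<not> (\<lambda>n. \<alpha> n / real n) \<longlonglongrightarrow> 0"
    if \<alpha>: "\<forall>n. 1 \<le> \<alpha> n" and approx: "\<forall>n. mmrf_approximation n (\<alpha> n) M A"
    for \<alpha> :: "nat \<Rightarrow> real" and M :: "'r measure"
      and A :: "'r \<Rightarrow> 'a set \<Rightarrow> ('a collection, 'a option) policy"
  proof
    assume lim: "(\<lambda>n. \<alpha> n / real n) \<longlonglongrightarrow> 0"
    \<comment> \<open>For \<open>n = 0\<close> the quotient is 0 by convention; from
      \<open>n = 1\<close> on it stays at least 1, so it cannot tend to 0.\<close>
    have "1 \<le> \<alpha> n / real n" if n: "1 \<le> n" for n
    proof -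
      obtain B where "selection_approximation n (\<alpha> n) M B"
        using reduction n \<alpha> approx by blast
      moreover have "0 < \<alpha> n" using \<alpha> by (meson less_le_trans zero_less_one)
      ultimately have "real n \<le> \<alpha> n" using selection_approximation_ge by blast
      then show ?thesis using n by simp
    qed
    then have "1 \<le> (0::real)" by (intro LIMSEQ_le_const[OF lim]) blast
    then show False by simp
  qed
  with reduction show ?thesis by blast
qed

end
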